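(* Let $n,m,N\ge 1$ be integers, $T>0$, $A\subseteq\mathbb{R}^m$ a compact set, $F:\mathbb{R}^n\times A\to\mathbb{R}^n$ a continuous map, and $h:\mathbb{R}^n\times A\to\mathbb{R}^N$, $g:\mathbb{R}^n\to\mathbb{R}^N$ given maps. Assume there is a constant $C$ such that for all $x,y\in\mathbb{R}^n$ and $a\in A$: $|F(x,a)|,|g(x)|,|h(x,a)|\le C$, $|F(x,a)-F(y,a)|\le C|x-y|$, $|g(x)-g(y)|\le C|x-y|$ and $|h(x,a)-h(y,a)|\le C|x-y|$. Let $K\subseteq\mathbb{R}^N$ be a proper cone with dual cone $K^*$. Let $C_{x,t}[\alpha]\in\mathbb{R}^N$ be the vectorial cost of the control $\alpha\in\mathcal{A}$ and $S_{x,t}$ the closure of the set of attainable costs (see context). Then there exists at least one map $u:\mathbb{R}^n\times(0,T)\to\mathbb{R}^N$ which is a Pareto Minimal of the vectorial cost with respect to $\le_K$. In addition, any direction $\lambda\in K^*$ ($\lambda\neq 0$) generates a Pareto Minimal by considering the supporting hyperplane of (the convex hull of) $S_{x,t}$ which is normal to $\lambda$: there is a Pareto Minimal $u$ of the vectorial cost such that for every $(x,t)\in\mathbb{R}^n\times(0,T)$ the point $u(x,t)\in S_{x,t}$ lies on that hyperplane, that is, $\lambda\cdot u(x,t)=\min_{\eta\in S_{x,t}}\lambda\cdot\eta$.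
   Context: A cone $K\subseteq\mathbb{R}^N$ is a non-empty set such that $\xi\in K$ implies $t\xi\in K$ for any $t\ge 0$. It is a proper cone if it is closed and convex, has non-empty interior, and $\xi\in K$ and $-\xi\in K$ imply $\xi=0$. It induces the partial ordering $\xi\le_K\eta \iff \eta-\xi\in K$. Its dual cone is $K^*=\{\eta\in\mathbb{R}^N : \eta\cdot\xi\ge 0 \text{ for all } \xi\in K\}$. The admissible controls are $\mathcal{A}=\{\alpha\in L^\infty(0,T) : \alpha(t)\in A \text{ for a.e. } t\in(0,T)\}$. For $(x,t)\in\mathbb{R}^n\times(0,T)$ and $\alpha\in\mathcal{A}$, let $\chi$ be the solution of $\dot\chi(s)=F(\chi(s),\alpha(s))$ for $t<s<T$, $\chi(t)=x$. The vectorial cost functional is $$C_{x,t}[\alpha]=g(\chi(T))+\int_t^T h(\chi(s),\alpha(s))\,ds\in\mathbb{R}^N .$$ Set $S_{x,t}=\overline{\{C_{x,t}[\alpha] : \alpha\in\mathcal{A}\}}\subseteq\mathbb{R}^N$. A map $u:\mathbb{R}^n\times(0,T)\to\mathbb{R}^N$ is a Pareto Minimal of the cost (a vectorial value map) if for every $(x,t)\in\mathbb{R}^n\times(0,T)$ one has $u(x,t)\in S_{x,t}$ and, for all $\eta\in S_{x,t}$ with $\eta\le_K u(x,t)$, $\eta=u(x,t)$. The supporting hyperplane of (the convex hull of) $S_{x,t}$ normal to $\lambda$ is the one for which $\lambda$ points into the halfspace containing $S_{x,t}$, i.e. $\{\eta\in\mathbb{R}^N : \lambda\cdot\eta=\min_{\zeta\in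 S_{x,t}}\lambda\cdot\zeta\}$. *)

theory Defs
  imports "HOL-Analysis.Analysis"
begin

text \<open>The library's \<^const>\<open>cone\<close> admits the empty set, hence the extra conjunct.\<close>
definition proper_cone :: "(real ^ 'N) set \<Rightarrow> bool" where
  "proper_cone K \<longleftrightarrow> K \<noteq> {} \<and> cone K \<and> closed K \<and> convex K \<and> interior K \<noteq> {} \<and>
     (\<forall>\<xi>. \<xi> \<in> K \<and> - \<xi> \<in> K \<longrightarrow> \<xi> = 0)"

definition cone_le :: "(real ^ 'N) set \<Rightarrow> real ^ 'N \<Rightarrow> real ^ 'N \<Rightarrow> bool" where
  "cone_le K \<xi> \<eta> \<longleftrightarrow> \<eta> - \<xi> \<in> K"

definition dual_cone :: "(real ^ 'N) set \<Rightarrow> (real ^ 'N) set" where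
  "dual_cone K = {\<eta>. \<forall>\<xi>\<in>K. 0 \<le> \<eta> \<bullet> \<xi>}"

text \<open>Elements of $L^\infty(0,T)$ are represented by functions on the real line; the values
  outside the open interval and on null sets are irrelevant to all notions below.\<close>
definition controls :: "real \<Rightarrow> (real ^ 'm) set \<Rightarrow> (real \<Rightarrow> real ^ 'm) set" where
  "controls T A = {\<alpha>. \<alpha> \<in> borel_measurable (lebesgue_on {0<..<T}) \<and>
     (\<exists>B. AE s in lebesgue_on {0<..<T}. norm (\<alpha> s) \<le> B) \<and>
     (AE s in lebesgue_on {0<..<T}. \<alpha> s \<in> A)}"

definition absolutely_continuous_on_interval ::
    "real \<Rightarrow> real \<Rightarrow> (real \<Rightarrow> 'a::real_normed_vector) \<Rightarrow> bool" where
  "absolutely_continuous_on_interval a b f \<longleftrightarrow>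
     (\<forall>\<epsilon>>0. \<exists>\<delta>>0. \<forall>(k::nat) (l::nat \<Rightarrow> real) (r::nat \<Rightarrow> real).
        (\<forall>i<k. a \<le> l i \<and> l i \<le> r i \<and> r i \<le> b) \<and>
        (\<forall>i<k. \<forall>j<k. i \<noteq> j \<longrightarrow> {l i<..<r i} \<inter> {l j<..<r j} = {}) \<and>
        (\<Sum>i<k. r i - l i) < \<delta>
        \<longrightarrow> (\<Sum>i<k. norm (f (r i) - f (l i))) < \<epsilon>)"

text \<open>Since controls are merely measurable, the state equation is understood in the sense of
  Caratheodory: \<open>\<gamma>\<close> is absolutely continuous on $[t,T]$ and solves the equation
  almost everywhere.\<close>
definition trajectory ::
    "(real ^ 'n \<Rightarrow> real ^ 'm \<Rightarrow> real ^ 'n) \<Rightarrow> real \<Rightarrow> real ^ 'n \<Rightarrow> real \<Rightarrow>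
     (real \<Rightarrow> real ^ 'm) \<Rightarrow> (real \<Rightarrow> real ^ 'n) \<Rightarrow> bool" where
  "trajectory F T x t \<alpha> \<gamma> \<longleftrightarrow>
     absolutely_continuous_on_interval t T \<gamma> \<and> \<gamma> t = x \<and>
     (AE s in lebesgue_on {t<..<T}. (\<gamma> has_vector_derivative F (\<gamma> s) (\<alpha> s)) (at s))"

text \<open>The Bochner integral is \<open>0\<close> if the integrand is not measurable in time; nothing but
  boundedness and Lipschitz continuity in the state is ever assumed about \<open>h\<close>.\<close>
definition cost ::
    "(real ^ 'n \<Rightarrow> real ^ 'N) \<Rightarrow> (real ^ 'n \<Rightarrow> real ^ 'm \<Rightarrow> real ^ 'N) \<Rightarrow> real \<Rightarrow> real \<Rightarrow>
     (real \<Rightarrow> real ^ 'm) \<Rightarrow> (real \<Rightarrow> real ^ 'n) \<Rightarrow> real ^ 'N" where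
  "cost g h T t \<alpha> \<gamma> = g (\<gamma> T) + (LINT s|lebesgue_on {t<..<T}. h (\<gamma> s) (\<alpha> s))"

text \<open>The closure $S_{x,t}$ of the set of attainable costs. For $F$ continuous, and bounded and
  Lipschitz in the state, a control determines its trajectory on $[t,T]$, so
  \<open>cost g h T t \<alpha> \<gamma>\<close> below is $C_{x,t}[\alpha]$.\<close>
definition attainable_costs ::
    "(real ^ 'n \<Rightarrow> real ^ 'm \<Rightarrow> real ^ 'n) \<Rightarrow> (real ^ 'n \<Rightarrow> real ^ 'N) \<Rightarrow>
     (real ^ 'n \<Rightarrow> real ^ 'm \<Rightarrow> real ^ 'N) \<Rightarrow> real \<Rightarrow> (real ^ 'm) set \<Rightarrow>
     real ^ 'n \<Rightarrow> real \<Rightarrow> (real ^ 'N) set" where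
  "attainable_costs F g h T A x t =
     closure {cost g h T t \<alpha> \<gamma> | \<alpha> \<gamma>. \<alpha> \<in> controls T A \<and> trajectory F T x t \<alpha> \<gamma>}"

definition pareto_minimal ::
    "(real ^ 'n \<Rightarrow> real ^ 'm \<Rightarrow> real ^ 'n) \<Rightarrow> (real ^ 'n \<Rightarrow> real ^ 'N) \<Rightarrow>
     (real ^ 'n \<Rightarrow> real ^ 'm \<Rightarrow> real ^ 'N) \<Rightarrow> real \<Rightarrow> (real ^ 'm) set \<Rightarrow>
     (real ^ 'N) set \<Rightarrow> (real ^ 'n \<Rightarrow> real \<Rightarrow> real ^ 'N) \<Rightarrow> bool" where
  "pareto_minimal F g h T A K u \<longleftrightarrow>
     (\<forall>x. \<forall>t\<in>{0<..<T}. u x t \<in> attainable_costs F g h T A x t \<and>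
        (\<forall>\<eta>\<in>attainable_costs F g h T A x t. cone_le K \<eta> (u x t) \<longrightarrow> \<eta> = u x t))"

text \<open>Here \<open>\<zeta>\<close> is a point at which the minimum of \<open>\<nu> \<bullet> \<zeta>\<close> over \<open>S\<close> is attained; without such a
  point the set is empty.\<close>
definition supporting_hyperplane :: "real ^ 'N \<Rightarrow> (real ^ 'N) set \<Rightarrow> (real ^ 'N) set" where
  "supporting_hyperplane \<nu> S =
     {\<eta>. \<exists>\<zeta>\<in>S. (\<forall>\<zeta>'\<in>S. \<nu> \<bullet> \<zeta> \<le> \<nu> \<bullet> \<zeta>') \<and> \<nu> \<bullet> \<eta> = \<nu> \<bullet> \<zeta>}"

end

theory Submission
  imports Defs
begin

text \<open>
  Fix a point \<open>(x, t)\<close> and let \<open>S\<close> be the closure of its attainable costs. Everything rests on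
  \<open>S\<close> being compact and non-empty, together with one linear functional \<open>\<mu>\<close> that is strictly
  positive on \<open>K - {0}\<close>.

  Given \<open>\<nu>\<close> in the dual cone, the minimisers of \<open>\<nu>\<close> over \<open>S\<close> form a compact face, but such a
  minimiser need not be Pareto minimal when \<open>\<nu>\<close> lies on the boundary of the dual cone and so
  vanishes on some ray of \<open>K\<close>. The tie is broken by minimising \<open>\<mu>\<close> over that face: a competitor
  below the chosen point cannot increase \<open>\<nu>\<close>, hence stays in the face, cannot increase \<open>\<mu>\<close> by
  moving down, and cannot decrease it by minimality; strict positivity of \<open>\<mu>\<close> leaves no room for
  it to differ (\<open>pareto_point_on_supporting_hyperplane\<close>). The plain existence claim is the
  degenerate case \<open>\<nu> = 0\<close>, where the face is all of \<open>S\<close>.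

  The functional \<open>\<mu>\<close> exists because a pointed closed cone has a compact convex base avoiding the
  origin, which can be strictly separated from it (\<open>pointed_cone_strictly_positive_functional\<close>).

  Boundedness of \<open>S\<close> is immediate from the bounds on \<open>g\<close> and \<open>h\<close>. That \<open>S\<close> is non-empty is a
  genuine existence statement: some control must admit a trajectory. A constant control suffices,
  since it turns the state equation into an autonomous Lipschitz equation, solved globally by a
  contraction argument (\<open>lipschitz_ode_has_solution\<close>).
\<close>

section \<open>Lipschitz differential equations and existence of a trajectory\<close>

text \<open>
  Continuous functions on a compact interval become elements of the Banach space of bounded continuous
  functions on the line by freezing them outside the interval.
\<close>
lemma clamp_in_bcontfun:
  fixes f :: "real \<Rightarrow> 'a::metric_space"
  assumes "continuous_on {a..b} f"
  shows "(\<lambda>s. f (clamp a b s)) \<in> bcontfun"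
proof -
  have "bounded (f ` cbox a b)"
    using assms by (intro compact_imp_bounded compact_continuous_image) auto
  then show ?thesis
    using assms by (simp add: bcontfun_def clamp_continuous_on clamp_bounded)
qed

text \<open>
  The integral operator is contracted globally, without gluing short-time solutions, by working
  with \<open>v s = exp (- k * s) *\<^sub>R y s\<close>, where \<open>y\<close> is the solution sought and \<open>k\<close> exceeds the
  Lipschitz constant \<open>L\<close>: integrating \<open>exp (k * r)\<close> gains a factor \<open>1 / k\<close>, so the operator has
  Lipschitz constant \<open>L / k\<close> in the supremum norm whatever the length of the interval.
\<close>
lemma lipschitz_ode_has_solution:
  fixes f :: "'a::banach \<Rightarrow> 'a"
  assumes "a \<le> b" and lip: "L-lipschitz_on UNIV f"
  obtains y where "y a = x"
    and "\<And>s. s \<in> {a..b} \<Longrightarrow> (y has_vector_derivative f (y s)) (at s within {a..b})"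
proof -
  have L: "0 \<le> L"
    using lip by (rule lipschitz_on_nonneg)
  define k where "k = L + 1"
  have k: "0 < k"
    using L by (simp add: k_def)
  define w where "w v r = f (exp (k * r) *\<^sub>R v r)" for v :: "real \<Rightarrow> 'a" and r
  define P where "P v s = exp (- k * s) *\<^sub>R (x + integral {a..s} (w v))" for v s
  define \<Phi> where "\<Phi> v = Bcontfun (\<lambda>s. P (apply_bcontfun v) (clamp a b s))" for v
  have contw: "continuous_on X (w (apply_bcontfun v))" for X v
    unfolding w_def
    by (rule continuous_on_compose2[OF lipschitz_on_continuous_on[OF lip]])
      (auto intro!: continuous_intros)
  have "continuous_on {a..b} (P (apply_bcontfun v))" for v
    unfolding P_def
    by (intro continuous_intros indefinite_integral_continuous_1 integrable_continuous_real contw)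
  then have \<Phi>: "apply_bcontfun (\<Phi> v) s = P (apply_bcontfun v) (clamp a b s)" for v s
    unfolding \<Phi>_def by (simp add: Bcontfun_inverse clamp_in_bcontfun)
  have contraction: "dist (\<Phi> u) (\<Phi> v) \<le> L / k * dist u v" for u v
  proof (rule dist_bound)
    fix s' :: real
    define s where "s = clamp a b s'"
    define D where "D = dist u v"
    have s: "a \<le> s" "s \<le> b"
      using clamp_in_interval[of a b s'] \<open>a \<le> b\<close> by (auto simp: s_def)
    have D: "0 \<le> D"
      by (simp add: D_def)
    have primitive: "((\<lambda>r. L * D * exp (k * r)) has_integral
        L * D / k * exp (k * s) - L * D / k * exp (k * a)) {a..s}"
      using k by (intro fundamental_theorem_of_calculus s)
        (auto intro!: derivative_eq_intros simp flip: has_real_derivative_iff_has_vector_derivative)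
    have integrand: "norm (w u r - w v r) \<le> L * D * exp (k * r)" for r
    proof -
      have "norm (w u r - w v r) \<le> L * norm (exp (k * r) *\<^sub>R u r - exp (k * r) *\<^sub>R v r)"
        using lipschitz_onD[OF lip] by (simp add: w_def dist_norm)
      also have "norm (exp (k * r) *\<^sub>R u r - exp (k * r) *\<^sub>R v r) = exp (k * r) * dist (u r) (v r)"
        by (simp add: dist_norm flip: scaleR_diff_right)
      also have "L * (exp (k * r) * dist (u r) (v r)) \<le> L * (exp (k * r) * D)"
        unfolding D_def using L by (intro mult_left_mono dist_bounded) auto
      finally show ?thesis
        by (simp add: mult_ac)
    qed
    have int: "w (apply_bcontfun z) integrable_on {a..s}" for z
      by (intro integrable_continuous_real contw)
    have "dist (\<Phi> u s') (\<Phi> v s') = exp (- k * s) * norm (integral {a..s} (w u) - integral {a..s} (w v))"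
      by (simp add: \<Phi> P_def dist_norm flip: s_def scaleR_diff_right)
    also have "\<dots> = exp (- k * s) * norm (integral {a..s} (\<lambda>r. w u r - w v r))"
      by (simp add: integral_diff int)
    also have "\<dots> \<le> exp (- k * s) * integral {a..s} (\<lambda>r. L * D * exp (k * r))"
      using primitive int integrand
      by (intro mult_left_mono integral_norm_bound_integral) (auto intro: integrable_diff)
    also have "\<dots> = exp (- k * s) * (L * D / k * exp (k * s) - L * D / k * exp (k * a))"
      by (simp only: integral_unique[OF primitive])
    also have "\<dots> \<le> exp (- k * s) * (L * D / k * exp (k * s))"
      using L D k by (intro mult_left_mono) auto
    also have "\<dots> = L / k * D"
      by (simp add: exp_minus)
    finally show "dist (\<Phi> u s') (\<Phi> v s') \<le> L / k * dist u v"
      by (simp add: D_def)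
  qed
  have "0 \<le> L / k" "L / k < 1"
    using L by (auto simp: k_def)
  then obtain v where v: "\<Phi> v = v"
    using banach_fix_type[of "L / k" \<Phi>] contraction by blast
  define y where "y s = x + integral {a..s} (w v)" for s
  have fixpoint: "w v s = f (y s)" if "s \<in> {a..b}" for s
  proof -
    have "v s = P v s"
      using \<Phi>[of v s] that by (simp add: v)
    then show ?thesis
      by (simp add: w_def y_def P_def exp_minus)
  qed
  show thesis
  proof
    show "y a = x"
      by (simp add: y_def)
    show "(y has_vector_derivative f (y s)) (at s within {a..b})" if "s \<in> {a..b}" for s
      unfolding fixpoint[OF that, symmetric] unfolding y_def
      using integral_has_vector_derivative[OF contw that]
      by (auto intro!: derivative_eq_intros)
  qed
qed

lemma lipschitz_imp_absolutely_continuous: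
  fixes \<gamma> :: "real \<Rightarrow> 'a::real_normed_vector"
  assumes lip: "C-lipschitz_on {a..b} \<gamma>"
  shows "absolutely_continuous_on_interval a b \<gamma>"
  unfolding absolutely_continuous_on_interval_def
proof (intro allI impI)
  fix \<epsilon> :: real
  assume \<epsilon>: "0 < \<epsilon>"
  have C: "0 \<le> C"
    using lip by (rule lipschitz_on_nonneg)
  have main: "(\<Sum>i<n. norm (\<gamma> (r i) - \<gamma> (l i))) < \<epsilon>"
    if ends: "\<forall>i<n. a \<le> l i \<and> l i \<le> r i \<and> r i \<le> b"
      and small: "(\<Sum>i<n. r i - l i) < \<epsilon> / (C + 1)" for n :: nat and l r :: "nat \<Rightarrow> real"
  proof -
    have nonneg: "0 \<le> (\<Sum>i<n. r i - l i)"
      using ends by (intro sum_nonneg) auto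
    have "(\<Sum>i<n. norm (\<gamma> (r i) - \<gamma> (l i))) \<le> (\<Sum>i<n. C * (r i - l i))"
    proof (rule sum_mono)
      fix i assume "i \<in> {..<n}"
      then have "a \<le> l i" "l i \<le> r i" "r i \<le> b"
        using ends by auto
      then show "norm (\<gamma> (r i) - \<gamma> (l i)) \<le> C * (r i - l i)"
        using lipschitz_onD[OF lip, of "r i" "l i"] by (simp add: dist_norm)
    qed
    also have "\<dots> = C * (\<Sum>i<n. r i - l i)"
      by (simp add: sum_distrib_left)
    also have "\<dots> \<le> (C + 1) * (\<Sum>i<n. r i - l i)"
      using nonneg by (intro mult_right_mono) auto
    also have "\<dots> < \<epsilon>"
      using small C by (simp add: field_simps)
    finally show ?thesis .
  qed
  show "\<exists>\<delta>>0. \<forall>(n::nat) l r.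
      (\<forall>i<n. a \<le> l i \<and> l i \<le> r i \<and> r i \<le> b) \<and>
      (\<forall>i<n. \<forall>j<n. i \<noteq> j \<longrightarrow> {l i<..<r i} \<inter> {l j<..<r j} = {}) \<and>
      (\<Sum>i<n. r i - l i) < \<delta> \<longrightarrow> (\<Sum>i<n. norm (\<gamma> (r i) - \<gamma> (l i))) < \<epsilon>"
    \<comment> \<open>The summand \<open>1\<close> keeps the quotient meaningful when \<open>C = 0\<close>.\<close>
    using \<epsilon> C main by (intro exI[of _ "\<epsilon> / (C + 1)"]) auto
qed

lemma constant_control_has_trajectory:
  fixes F :: "real ^ 'n \<Rightarrow> real ^ 'm \<Rightarrow> real ^ 'n"
  assumes "t \<le> T" and bound: "\<And>x. norm (F x c) \<le> C"
    and lip: "\<And>x y. norm (F x c - F y c) \<le> C * norm (x - y)"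
  obtains \<gamma> where "trajectory F T x t (\<lambda>_. c) \<gamma>"
proof -
  have C: "0 \<le> C"
    using order_trans[OF norm_ge_zero bound] .
  have "C-lipschitz_on UNIV (\<lambda>x. F x c)"
    using C lip by (intro lipschitz_onI) (auto simp: dist_norm)
  then obtain \<gamma> where start: "\<gamma> t = x"
    and deriv: "\<And>s. s \<in> {t..T} \<Longrightarrow> (\<gamma> has_vector_derivative F (\<gamma> s) c) (at s within {t..T})"
    using lipschitz_ode_has_solution[OF \<open>t \<le> T\<close>, where x = x] by blast
  have "C-lipschitz_on {t..T} \<gamma>"
  proof (rule lipschitz_onI)
    fix r s assume "r \<in> {t..T}" "s \<in> {t..T}"
    moreover have "onorm (\<lambda>h. h *\<^sub>R F (\<gamma> s) c) \<le> C" for s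
      using bound by (intro onorm_bound C) (simp add: mult.commute[of C] mult_left_mono)
    ultimately show "dist (\<gamma> r) (\<gamma> s) \<le> C * dist r s"
      using deriv unfolding dist_norm has_vector_derivative_def
      by (intro differentiable_bound[where S = "{t..T}"]) auto
  qed (rule C)
  then have "absolutely_continuous_on_interval t T \<gamma>"
    by (rule lipschitz_imp_absolutely_continuous)
  moreover have "(\<gamma> has_vector_derivative F (\<gamma> s) c) (at s)" if "s \<in> {t<..<T}" for s
    using deriv[of s] that by (simp add: at_within_Icc_at)
  ultimately have "trajectory F T x t (\<lambda>_. c) \<gamma>"
    using start by (auto simp: trajectory_def intro!: AE_I2)
  then show thesis
    by (rule that)
qed

section \<open>Compactness of the set of attainable costs\<close>

text \<open>
  If the running cost happens to be non-measurable in time along the trajectory, its Bochner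
  integral is \<open>0\<close>, which obeys the same bound; so both cases are covered at once.
\<close>
lemma norm_cost_le:
  assumes "\<alpha> \<in> controls T A" "0 \<le> t" "t \<le> T" "0 \<le> C"
    and g: "\<And>x. norm (g x) \<le> C" and h: "\<And>x a. a \<in> A \<Longrightarrow> norm (h x a) \<le> C"
  shows "norm (cost g h T t \<alpha> \<gamma>) \<le> C + C * (T - t)"
proof -
  let ?M = "lebesgue_on {t<..<T}"
  have "AE s in ?M. \<alpha> s \<in> A"
    using assms(1) \<open>0 \<le> t\<close>
    by (auto simp: controls_def AE_restrict_space_iff elim!: eventually_mono)
  then have h_le: "AE s in ?M. norm (h (\<gamma> s) (\<alpha> s)) \<le> C"
    by eventually_elim (rule h)
  have const: "integrable ?M (\<lambda>_. C)"
    by (intro finite_measure.integrable_const finite_measure_lebesgue_on) simp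
  have "norm (LINT s|?M. h (\<gamma> s) (\<alpha> s)) \<le> (LINT s|?M. norm (h (\<gamma> s) (\<alpha> s)))"
    by (rule integral_norm_bound)
  also have "\<dots> \<le> (LINT s|?M. C)"
    using h_le \<open>0 \<le> C\<close> by (intro integral_mono_AE' const) auto
  also have "\<dots> = C * (T - t)"
    using \<open>t \<le> T\<close> by (simp add: measure_restrict_space)
  finally show ?thesis
    unfolding cost_def by (intro norm_triangle_mono g)
qed

lemma compact_attainable_costs:
  assumes "0 \<le> t" "t \<le> T" "0 \<le> C"
    and "\<And>x. norm (g x) \<le> C" "\<And>x a. a \<in> A \<Longrightarrow> norm (h x a) \<le> C"
  shows "compact (attainable_costs F g h T A x t)"
proof -
  have "bounded {cost g h T t \<alpha> \<gamma> | \<alpha> \<gamma>. \<alpha> \<in> controls T A \<and> trajectory F T x t \<alpha> \<gamma>}"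
    using norm_cost_le[where g = g and h = h and A = A, OF _ assms] by (auto simp: bounded_iff)
  then show ?thesis
    by (simp add: attainable_costs_def compact_closure)
qed

lemma attainable_costs_nonempty:
  assumes "c \<in> A" and "t \<le> T" and "\<And>x. norm (F x c) \<le> C"
    and "\<And>x y. norm (F x c - F y c) \<le> C * norm (x - y)"
  shows "attainable_costs F g h T A x t \<noteq> {}"
proof -
  obtain \<gamma> where "trajectory F T x t (\<lambda>_. c) \<gamma>"
    using constant_control_has_trajectory[where F = F and c = c, OF assms(2-4)] .
  moreover have "(\<lambda>_. c) \<in> controls T A"
    using \<open>c \<in> A\<close> by (auto simp: controls_def)
  ultimately show ?thesis
    by (auto simp: attainable_costs_def)
qed

section \<open>Pareto minimal points of a compact set\<close>

text \<open>
  The part of the cone on the unit sphere is compact, so its convex hull is a compact convex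
  set. The hull misses the origin: for a pointed convex cone \<open>K - {0}\<close> is itself convex, because
  a vanishing combination of two non-zero elements would put some non-zero vector and its
  negative in \<open>K\<close>. Strict separation of the hull from the origin gives the functional, and
  scaling extends positivity from the sphere to the cone.
\<close>
lemma pointed_cone_strictly_positive_functional:
  fixes K :: "'a::euclidean_space set"
  assumes cone: "cone K" and "closed K" "convex K"
    and pointed: "\<And>\<xi>. \<xi> \<in> K \<Longrightarrow> - \<xi> \<in> K \<Longrightarrow> \<xi> = 0"
  obtains \<mu> where "\<And>\<xi>. \<xi> \<in> K \<Longrightarrow> \<xi> \<noteq> 0 \<Longrightarrow> 0 < \<mu> \<bullet> \<xi>"
proof -
  let ?H = "convex hull (K \<inter> sphere 0 1)"
  have "compact ?H"
    using \<open>closed K\<close> by (intro compact_convex_hull closed_Int_compact compact_sphere)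
  have "convex (K - {0})"
    unfolding convex_alt
  proof clarify
    fix \<xi> \<eta> and u :: real
    assume \<xi>: "\<xi> \<in> K" "\<xi> \<noteq> 0" and \<eta>: "\<eta> \<in> K" "\<eta> \<noteq> 0" and u: "0 \<le> u" "u \<le> 1"
    have "(1 - u) *\<^sub>R \<xi> + u *\<^sub>R \<eta> \<in> K"
      using \<open>convex K\<close> \<xi> \<eta> u by (simp add: convex_alt)
    moreover have "(1 - u) *\<^sub>R \<xi> + u *\<^sub>R \<eta> \<noteq> 0"
    proof
      assume zero: "(1 - u) *\<^sub>R \<xi> + u *\<^sub>R \<eta> = 0"
      have mem: "(1 - u) *\<^sub>R \<xi> \<in> K" "u *\<^sub>R \<eta> \<in> K"
        using cone \<xi> \<eta> u by (auto simp: cone_def)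
      have "- ((1 - u) *\<^sub>R \<xi>) = u *\<^sub>R \<eta>"
        using zero by (simp add: minus_unique)
      then have "(1 - u) *\<^sub>R \<xi> = 0"
        using pointed[OF mem(1)] mem(2) by simp
      then show False
        using zero \<xi> \<eta> by auto
    qed
    ultimately show "(1 - u) *\<^sub>R \<xi> + u *\<^sub>R \<eta> \<in> K - {0}"
      by simp
  qed
  then have "?H \<subseteq> K - {0}"
    by (intro hull_minimal) auto
  then obtain \<mu> \<beta> where sep: "0 < \<beta>" "\<And>\<xi>. \<xi> \<in> ?H \<Longrightarrow> \<beta> < \<mu> \<bullet> \<xi>"
    using separating_hyperplane_closed_0[of ?H] \<open>compact ?H\<close>
    by (metis DiffD2 compact_imp_closed convex_convex_hull singletonI subset_iff)
  show thesis
  proof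
    fix \<xi> assume \<xi>: "\<xi> \<in> K" "\<xi> \<noteq> 0"
    then have "\<xi> /\<^sub>R norm \<xi> \<in> ?H"
      using cone by (intro hull_inc) (simp add: cone_def)
    then have "0 < \<mu> \<bullet> (\<xi> /\<^sub>R norm \<xi>)"
      using sep by force
    then show "0 < \<mu> \<bullet> \<xi>"
      using \<xi> by (simp add: zero_less_mult_iff)
  qed
qed

text \<open>
  The point is found by a lexicographic minimisation: \<open>\<nu>\<close> first, to land on the hyperplane, then
  a strictly positive functional on the resulting face, to exclude other points of \<open>S\<close> below it.
\<close>
lemma pareto_point_on_supporting_hyperplane:
  fixes K S :: "(real ^ 'a) set"
  assumes "proper_cone K" "\<nu> \<in> dual_cone K" "compact S" "S \<noteq> {}"
  obtains p where "p \<in> S" "p \<in> supporting_hyperplane \<nu> S"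
    "\<And>\<eta>. \<eta> \<in> S \<Longrightarrow> cone_le K \<eta> p \<Longrightarrow> \<eta> = p"
proof -
  obtain \<mu> where \<mu>: "\<And>\<xi>. \<xi> \<in> K \<Longrightarrow> \<xi> \<noteq> 0 \<Longrightarrow> 0 < \<mu> \<bullet> \<xi>"
    using pointed_cone_strictly_positive_functional[of K] \<open>proper_cone K\<close>
    unfolding proper_cone_def by blast
  have cont: "continuous_on X ((\<bullet>) \<kappa>)" for X and \<kappa> :: "real ^ 'a"
    by (intro continuous_intros)
  obtain \<zeta> where \<zeta>: "\<zeta> \<in> S" "\<And>\<eta>. \<eta> \<in> S \<Longrightarrow> \<nu> \<bullet> \<zeta> \<le> \<nu> \<bullet> \<eta>"
    using continuous_attains_inf[OF assms(3,4) cont[where \<kappa> = \<nu>]] by blast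
  define face where "face = S \<inter> {\<eta>. \<nu> \<bullet> \<eta> = \<nu> \<bullet> \<zeta>}"
  have "compact face" "face \<noteq> {}"
    using \<open>compact S\<close> \<zeta> by (auto simp: face_def intro: compact_Int_closed closed_hyperplane)
  from continuous_attains_inf[OF this cont[where \<kappa> = \<mu>]] obtain p where p: "p \<in> face" "\<And>\<eta>. \<eta> \<in> face \<Longrightarrow> \<mu> \<bullet> p \<le> \<mu> \<bullet> \<eta>"
    by blast
  show thesis
  proof
    show "p \<in> S" "p \<in> supporting_hyperplane \<nu> S"
      using p(1) \<zeta> by (auto simp: face_def supporting_hyperplane_def)
    fix \<eta> assume "\<eta> \<in> S" "cone_le K \<eta> p"
    then have diff: "p - \<eta> \<in> K"
      by (simp add: cone_le_def)
    then have "0 \<le> \<nu> \<bullet> (p - \<eta>)"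
      using \<open>\<nu> \<in> dual_cone K\<close> by (simp add: dual_cone_def)
    then have "\<eta> \<in> face"
      using \<open>\<eta> \<in> S\<close> p(1) \<zeta>(2)[of \<eta>] by (simp add: face_def inner_diff_right)
    then have "\<not> 0 < \<mu> \<bullet> (p - \<eta>)"
      using p(2)[of \<eta>] by (simp add: inner_diff_right)
    then show "\<eta> = p"
      using \<mu>[OF diff] by auto
  qed
qed

section \<open>Existence of Pareto minimal value maps\<close>

theorem lemma3p2:
  fixes F :: "real ^ 'n \<Rightarrow> real ^ 'm \<Rightarrow> real ^ 'n"
    and g :: "real ^ 'n \<Rightarrow> real ^ 'N"
    and h :: "real ^ 'n \<Rightarrow> real ^ 'm \<Rightarrow> real ^ 'N"
    and A :: "(real ^ 'm) set"
    and K :: "(real ^ 'N) set"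
    and T C :: real
  assumes "T > 0"
    and "compact A" and "A \<noteq> {}"
    and "continuous_on (UNIV \<times> A) (\<lambda>(x, a). F x a)"
    and "\<And>x a. a \<in> A \<Longrightarrow> norm (F x a) \<le> C"
    and "\<And>x. norm (g x) \<le> C"
    and "\<And>x a. a \<in> A \<Longrightarrow> norm (h x a) \<le> C"
    and "\<And>x y a. a \<in> A \<Longrightarrow> norm (F x a - F y a) \<le> C * norm (x - y)"
    and "\<And>x y. norm (g x - g y) \<le> C * norm (x - y)"
    and "\<And>x y a. a \<in> A \<Longrightarrow> norm (h x a - h y a) \<le> C * norm (x - y)"
    and "proper_cone K"
  shows "(\<exists>u. pareto_minimal F g h T A K u) \<and>
    (\<forall>\<nu>\<in>dual_cone K. \<nu> \<noteq> 0 \<longrightarrow>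
       (\<exists>u. pareto_minimal F g h T A K u \<and>
          (\<forall>x. \<forall>t\<in>{0<..<T}.
             u x t \<in> supporting_hyperplane \<nu> (attainable_costs F g h T A x t))))"
proof -
  obtain c where c: "c \<in> A"
    using \<open>A \<noteq> {}\<close> by blast
  have "0 \<le> C"
    using order_trans[OF norm_ge_zero assms(6)] .
  have main: "\<exists>u. pareto_minimal F g h T A K u \<and>
      (\<forall>x. \<forall>t\<in>{0<..<T}. u x t \<in> supporting_hyperplane \<nu> (attainable_costs F g h T A x t))"
    if \<nu>: "\<nu> \<in> dual_cone K" for \<nu>
  proof -
    let ?S = "attainable_costs F g h T A"
    let ?good = "\<lambda>x t p. p \<in> ?S x t \<and> p \<in> supporting_hyperplane \<nu> (?S x t) \<and>
      (\<forall>\<eta>\<in>?S x t. cone_le K \<eta> p \<longrightarrow> \<eta> = p)"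
    have "\<exists>p. ?good x t p" if "t \<in> {0<..<T}" for x t
    proof -
      have "compact (?S x t)"
        using that \<open>0 \<le> C\<close> assms(6,7) by (intro compact_attainable_costs[where C = C]) auto
      moreover have "?S x t \<noteq> {}"
        using that c assms(5,8) by (intro attainable_costs_nonempty[where C = C]) auto
      ultimately show ?thesis
        using pareto_point_on_supporting_hyperplane[OF \<open>proper_cone K\<close> \<nu>] by metis
    qed
    then have "?good x t (SOME p. ?good x t p)" if "t \<in> {0<..<T}" for x t
      using that by (intro someI_ex[of "?good x t"]) blast
    then show ?thesis
      unfolding pareto_minimal_def
      by (intro exI[of _ "\<lambda>x t. SOME p. ?good x t p"]) blast
  qed
  have "0 \<in> dual_cone K"
    by (simp add: dual_cone_def)
  with main show ?thesis
    by blast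
qed

end
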